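(* Let $n\ge 3$. The restriction map $\rho$, sending an optimal acyclic matching $V$ on $\Delta^n$ to the set of pairs of $V$ lying in $\Delta^n_{(n-2)}$, is a surjection from the set of optimal acyclic matchings on $\Delta^n$ onto the set of optimal acyclic matchings on $\Delta^n_{(n-2)}$, and every fiber of $\rho$ has exactly $n+1$ elements. Consequently $$f(n)=(n+1)\cdot\bigl|\{\text{top-dimensional simplices of }\mathcal{M}(\Delta^n_{(n-2)})\}\bigr|,$$ where $f(n)$ is the number of optimal acyclic matchings on $\Delta^n$.
   Context: All simplicial complexes are finite abstract simplicial complexes; simplices are nonempty. $\Delta^n$ is the simplicial complex of all nonempty subsets of an $(n+1)$-element vertex set; $\Delta^n_{(k)}$ denotes its $k$-skeleton. The Hasse diagram $\mathcal{H}(K)$ of $K$ is the directed graph whose vertices are the simplices of $K$, with an edge $\sigma\to\tau$ whenever $\sigma\subsetneq\tau$ and $\dim\tau=\dim\sigma+1$. A matching on $\mathcal{H}(K)$ is a set $W$ of edges of $\mathcal{H}(K)$, no two sharing a vertex; an edge $\sigma\to\tau$ in $W$ is called a pair $(\sigma,\tau)$, and a simplex lying in no pair is called critical. $W$ is acyclic if the directed graph obtained from $\mathcal{H}(K)$ by reversing every edge in $W$ has no directed cycle. The complex of discrete Morse matchings $\mathcal{M}(K)$ is the simplicial complex whose vertices are the edges of $\mathcal{H}(K)$ and whose simplices are the nonempty acyclic matchings (a matching with $k+1$ pairs is a $k$-simplex). An acyclic matching is optimal if it minimizes the total number of critical simplices among all acyclic matchings on $K$; equivalently it is a top-dimensional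 simplex of $\mathcal{M}(K)$. *)

theory Defs
  imports Main
begin

text \<open>Abstract simplicial complexes are represented as sets of (nonempty, finite) vertex sets.\<close>

definition std_simplex :: "nat \<Rightarrow> nat set set" where
  "std_simplex n = {\<sigma>. \<sigma> \<subseteq> {0..n} \<and> \<sigma> \<noteq> {}}"

definition skeleton :: "nat \<Rightarrow> 'a set set \<Rightarrow> 'a set set" where
  "skeleton k K = {\<sigma>\<in>K. card \<sigma> \<le> k + 1}"

definition hasse_edges :: "'a set set \<Rightarrow> ('a set \<times> 'a set) set" where
  "hasse_edges K = {(\<sigma>, \<tau>). \<sigma> \<in> K \<and> \<tau> \<in> K \<and> \<sigma> \<subset> \<tau> \<and> card \<tau> = card \<sigma> + 1}"

definition is_matching :: "'a set set \<Rightarrow> ('a set \<times> 'a set) set \<Rightarrow> bool" where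
  "is_matching K W \<longleftrightarrow> W \<subseteq> hasse_edges K \<and>
     (\<forall>e\<in>W. \<forall>e'\<in>W. e \<noteq> e' \<longrightarrow> {fst e, snd e} \<inter> {fst e', snd e'} = {})"

definition acyclic_matching :: "'a set set \<Rightarrow> ('a set \<times> 'a set) set \<Rightarrow> bool" where
  "acyclic_matching K W \<longleftrightarrow> is_matching K W \<and> acyclic ((hasse_edges K - W) \<union> W\<inverse>)"

definition critical :: "'a set set \<Rightarrow> ('a set \<times> 'a set) set \<Rightarrow> 'a set set" where
  "critical K W = K - (fst ` W \<union> snd ` W)"

definition optimal_matchings :: "'a set set \<Rightarrow> ('a set \<times> 'a set) set set" where
  "optimal_matchings K = {W. acyclic_matching K W \<and>
     (\<forall>W'. acyclic_matching K W' \<longrightarrow> card (critical K W) \<le> card (critical K W'))}"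

definition morse_complex :: "'a set set \<Rightarrow> ('a set \<times> 'a set) set set" where
  "morse_complex K = {W. W \<noteq> {} \<and> acyclic_matching K W}"

definition top_simplices :: "'b set set \<Rightarrow> 'b set set" where
  "top_simplices M = {W\<in>M. \<forall>W'\<in>M. card W' \<le> card W}"

definition restrict_matching :: "'a set set \<Rightarrow> ('a set \<times> 'a set) set \<Rightarrow> ('a set \<times> 'a set) set" where
  "restrict_matching L V = {(\<sigma>, \<tau>)\<in>V. \<sigma> \<in> L \<and> \<tau> \<in> L}"

definition f_opt :: "nat \<Rightarrow> nat" where
  "f_opt n = card (optimal_matchings (std_simplex n))"

end

theory Submission
  imports Defs
begin

text \<open>An optimal matching on the simplex leaves a single vertex critical, so it pairs the top face with
  some facet \<open>T - {r}\<close> and every other facet \<open>T - {i}\<close> with a ridge \<open>T - {i, p i}\<close>.  Reading the ridge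
  \<open>T - {i, j}\<close> as an edge of the complete graph on the vertices, the critical ridges of an acyclic
  matching on the codimension-two skeleton form a connected spanning graph; by optimality it is a
  tree.  An extension to the whole simplex is then the same as a choice of root \<open>r\<close>, the function \<open>p\<close>
  being the parent map of the rooted tree, whence the \<open>n + 1\<close> preimages.\<close>

text \<open>The obstacle is the lower bound on the skeleton: its optimum has to be known exactly
  before restrictions can be called optimal. Topologically the skeleton is a wedge of
  \<open>n\<close> spheres of dimension \<open>n - 2\<close>, so the Morse inequalities give
  \<open>n + 1\<close> critical simplices. Homology is avoided by using acyclicity directly: some
  vertex stays critical, and every cut of the vertex set is crossed by a critical ridge, which
  already yields \<open>n\<close> critical ridges. The bound is attained by restricting a cone
  matching. Trees are likewise not treated as graphs: a root, a parent map and a depth decreasing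
  along it carry everything. The depth makes the extension acyclic, and it gives uniqueness: a map
  with the same root whose edges include all those of the parent map is equal to it. So no depth has
  to be extracted from a given matching on the whole simplex.\<close>

abbreviation morse_graph :: "'a set set \<Rightarrow> ('a set \<times> 'a set) set \<Rightarrow> ('a set \<times> 'a set) set" where
  "morse_graph K W \<equiv> (hasse_edges K - W) \<union> W\<inverse>"

section \<open>Acyclic relations\<close>

text \<open>The transitive closure is restricted to \<open>S\<close>, not \<open>r\<close> itself,
  because paths between members of \<open>S\<close> may run outside \<open>S\<close>. The
  restriction is finite and acyclic, hence well-founded.\<close>

lemma acyclic_finite_has_source:
  assumes "acyclic r" "finite S" "S \<noteq> {}"
  shows "\<exists>x\<in>S. \<forall>y\<in>S. (y, x) \<notin> r\<^sup>+"
proof -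
  have "acyclic (r\<^sup>+)"
    using assms(1) by (simp add: acyclic_def)
  then have "acyclic (r\<^sup>+ \<inter> S \<times> S)"
    by (rule acyclic_subset) auto
  moreover have "finite (r\<^sup>+ \<inter> S \<times> S)"
    using assms(2) by simp
  ultimately have wf: "wf (r\<^sup>+ \<inter> S \<times> S)"
    by (intro finite_acyclic_wf)
  then have "\<exists>x\<in>S. \<forall>y. (y, x) \<in> r\<^sup>+ \<inter> S \<times> S \<longrightarrow> y \<notin> S"
    using assms(3) unfolding wf_eq_minimal by blast
  then show ?thesis by blast
qed

lemma acyclic_finite_has_sink:
  assumes "acyclic r" "finite S" "S \<noteq> {}"
  shows "\<exists>x\<in>S. \<forall>y\<in>S. (x, y) \<notin> r\<^sup>+"
  using acyclic_finite_has_source[of "r\<inverse>" S] assms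
  by (simp add: acyclic_converse trancl_converse)

text \<open>A cycle that meets \<open>D\<close> stays in it, and \<open>f\<close> would decrease
  strictly all the way round; a cycle that avoids \<open>D\<close> is a cycle of \<open>S\<close>.
  Thus a matching can be enlarged while the acyclicity of the old part is reused.\<close>

lemma acyclic_by_closed_set:
  fixes f :: "'a \<Rightarrow> nat"
  assumes D: "\<And>x y. (x, y) \<in> R \<Longrightarrow> x \<in> D \<Longrightarrow> y \<in> D \<and> f y < f x"
    and S: "\<And>x y. (x, y) \<in> R \<Longrightarrow> x \<notin> D \<Longrightarrow> y \<notin> D \<Longrightarrow> (x, y) \<in> S"
    and "acyclic S"
  shows "acyclic R"
proof -
  have *: "(x \<in> D \<longrightarrow> y \<in> D \<and> f y < f x) \<and> (y \<notin> D \<longrightarrow> (x, y) \<in> S\<^sup>+)"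
    if "(x, y) \<in> R\<^sup>+" for x y
    using that
  proof (induction rule: trancl_induct)
    case (base y)
    then show ?case using D S by blast
  next
    case (step y z)
    show ?case
    proof (intro conjI impI)
      assume "x \<in> D"
      then have "y \<in> D" "f y < f x" using step.IH by auto
      then show "z \<in> D" "f z < f x" using D[OF step.hyps(2)] by auto
    next
      assume "z \<notin> D"
      then have "y \<notin> D" using D[OF step.hyps(2)] by blast
      then have "(x, y) \<in> S\<^sup>+" "(y, z) \<in> S"
        using step.IH S[OF step.hyps(2)] \<open>z \<notin> D\<close> by auto
      then show "(x, z) \<in> S\<^sup>+" by (rule trancl_into_trancl)
    qed
  qed
  show ?thesis
    using * \<open>acyclic S\<close> unfolding acyclic_def by blast
qed

section \<open>Matchings and critical simplices of an arbitrary complex\<close>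

lemma matching_pair_unique:
  assumes "is_matching K W" "(a, b) \<in> W" "(c, d) \<in> W" "a = c \<or> b = d \<or> a = d \<or> b = c"
  shows "a = c \<and> b = d"
proof -
  have "\<forall>e\<in>W. \<forall>e'\<in>W. e \<noteq> e' \<longrightarrow> {fst e, snd e} \<inter> {fst e', snd e'} = {}"
    using assms(1) unfolding is_matching_def by simp
  from bspec[OF bspec[OF this assms(2)] assms(3)] show ?thesis
    using assms(4) by auto
qed

lemma matching_edge:
  assumes "is_matching K W" "(a, b) \<in> W"
  shows "a \<in> K" "b \<in> K" "a \<subset> b" "card b = card a + 1"
  using assms unfolding is_matching_def hasse_edges_def by auto

lemma is_matchingI:
  assumes edge: "\<And>a b. (a, b) \<in> W \<Longrightarrow> (a, b) \<in> hasse_edges K"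
    and uniq: "\<And>a b c d. (a, b) \<in> W \<Longrightarrow> (c, d) \<in> W \<Longrightarrow>
      a = c \<or> a = d \<or> b = c \<or> b = d \<Longrightarrow> a = c \<and> b = d"
  shows "is_matching K W"
  unfolding is_matching_def
proof (intro conjI ballI impI)
  show "W \<subseteq> hasse_edges K" using edge by (rule subrelI)
  fix e e' assume e: "e \<in> W" "e' \<in> W" "e \<noteq> e'"
  obtain a b where ab: "e = (a, b)" by (cases e)
  obtain c d where cd: "e' = (c, d)" by (cases e')
  have "\<not> (a = c \<or> a = d \<or> b = c \<or> b = d)"
    using uniq[of a b c d] e unfolding ab cd by blast
  then show "{fst e, snd e} \<inter> {fst e', snd e'} = {}"
    unfolding ab cd by simp
qed

lemma critical_iff: "X \<in> critical K W \<longleftrightarrow> X \<in> K \<and> (\<forall>Y. (X, Y) \<notin> W \<and> (Y, X) \<notin> W)"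
  unfolding critical_def by (auto simp: image_iff)

text \<open>A pair uses up two simplices. This turns minimising critical simplices into maximising
  pairs, the link between optimal matchings and top-dimensional simplices.\<close>

lemma card_critical:
  assumes "is_matching K W" "finite K"
  shows "card (critical K W) + 2 * card W = card K"
proof -
  have "W \<subseteq> K \<times> K"
    using matching_edge[OF assms(1)] by auto
  then have fin: "finite W"
    using assms(2) by (meson finite_SigmaI finite_subset)
  have "inj_on fst W" "inj_on snd W"
    by (auto intro!: inj_onI dest: matching_pair_unique[OF assms(1)])
  then have c: "card (fst ` W) = card W" "card (snd ` W) = card W"
    by (simp_all add: card_image)
  have "(b, c) \<notin> W" if "(a, b) \<in> W" for a b c
    using matching_pair_unique[OF assms(1) that, of b c] matching_edge(3)[OF assms(1) that] by blast
  then have "fst ` W \<inter> snd ` W = {}"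
    by force
  then have "card (fst ` W \<union> snd ` W) = 2 * card W"
    using c fin by (simp add: card_Un_disjoint)
  moreover have sub: "fst ` W \<union> snd ` W \<subseteq> K"
    using \<open>W \<subseteq> K \<times> K\<close> by auto
  ultimately show ?thesis
    unfolding critical_def
    using card_mono[OF assms(2) sub] card_Diff_subset[OF finite_subset[OF sub assms(2)] sub] by simp
qed

text \<open>A matched vertex \<open>v\<close> is paired upwards with an edge, whose other end
  \<open>w\<close> gives a path from \<open>{w}\<close> over that edge down to \<open>{v}\<close>.
  If all vertices were matched, each would have a predecessor among the vertices, so none could be a
  source.\<close>

lemma acyclic_matching_critical_vertex:
  assumes W: "acyclic_matching K W" and "finite K" "{} \<notin> K" "{a} \<in> K"
    and closed: "\<And>X x. X \<in> K \<Longrightarrow> x \<in> X \<Longrightarrow> {x} \<in> K"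
  shows "\<exists>v. {v} \<in> critical K W"
proof (rule ccontr)
  assume none: "\<nexists>v. {v} \<in> critical K W"
  have M: "is_matching K W" and ac: "acyclic (morse_graph K W)"
    using W by (auto simp: acyclic_matching_def)
  let ?S = "{X \<in> K. card X = 1}"
  have "\<exists>Y\<in>?S. (Y, X) \<in> (morse_graph K W)\<^sup>+" if "X \<in> ?S" for X
  proof -
    have "X \<in> K" "card X = 1" using that by auto
    then obtain v where v: "X = {v}" "{v} \<in> K"
      by (metis card_1_singletonE)
    have "(Y, {v}) \<notin> W" for Y
      using matching_edge(1,3)[OF M, of Y "{v}"] \<open>{} \<notin> K\<close>
      by (auto simp: psubset_eq subset_singleton_iff)
    then obtain e where e: "({v}, e) \<in> W"
      using none v unfolding critical_def by force
    have "card e = 2" "v \<in> e" "e \<in> K"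
      using matching_edge[OF M e] by auto
    then obtain w where w: "e = {v, w}" "w \<noteq> v"
      by (auto simp: card_2_iff)
    have wK: "{w} \<in> K"
      using closed[OF \<open>e \<in> K\<close>] w by auto
    have "({w}, e) \<in> hasse_edges K"
      using wK \<open>e \<in> K\<close> w by (auto simp: hasse_edges_def)
    moreover have "({w}, e) \<notin> W"
      using matching_pair_unique[OF M e] w by blast
    ultimately have "({w}, e) \<in> morse_graph K W" "(e, {v}) \<in> morse_graph K W"
      using e by auto
    then have "({w}, {v}) \<in> (morse_graph K W)\<^sup>+"
      by (meson r_into_trancl' trancl_into_trancl)
    then show ?thesis using wK v by auto
  qed
  moreover have "{a} \<in> ?S" "finite ?S" using assms by auto
  ultimately show False
    using acyclic_finite_has_source[OF ac, of ?S] by blast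
qed

lemma optimal_matchings_iff:
  assumes "acyclic_matching K W\<^sub>0" "card (critical K W\<^sub>0) = m"
    and ge: "\<And>W. acyclic_matching K W \<Longrightarrow> m \<le> card (critical K W)"
  shows "W \<in> optimal_matchings K \<longleftrightarrow> acyclic_matching K W \<and> card (critical K W) = m"
proof
  assume "W \<in> optimal_matchings K"
  then have "acyclic_matching K W" "card (critical K W) \<le> m"
    using assms(1,2) unfolding optimal_matchings_def by auto
  then show "acyclic_matching K W \<and> card (critical K W) = m"
    using ge[of W] by simp
next
  assume "acyclic_matching K W \<and> card (critical K W) = m"
  then show "W \<in> optimal_matchings K"
    using ge unfolding optimal_matchings_def by simp
qed

section \<open>Spanning trees as parent maps with a depth\<close>

text \<open>Crossed cuts mean connectivity: otherwise the vertices that reach \<open>r\<close> would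
  form a cut with no edge leading into it. The depth is the distance to \<open>r\<close>, and the
  parent is the first step of a shortest path.\<close>

lemma parents_if_cuts_crossed:
  assumes "r \<in> T"
    and cut: "\<And>A. A \<subseteq> T \<Longrightarrow> r \<in> A \<Longrightarrow> A \<noteq> T \<Longrightarrow> \<exists>i\<in>A. \<exists>j\<in>T - A. adj j i"
  shows "\<exists>p d. d r = (0::nat) \<and> (\<forall>i\<in>T - {r}. p i \<in> T \<and> adj i (p i) \<and> d (p i) < d i)"
proof -
  define G where "G = {(i, j). i \<in> T \<and> j \<in> T \<and> adj i j}"
  define d where "d i = (LEAST k. (i, r) \<in> G ^^ k)" for i
  have reach: "(i, r) \<in> G\<^sup>*" if "i \<in> T" for i
  proof (rule ccontr)
    assume i: "(i, r) \<notin> G\<^sup>*"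
    let ?A = "{i \<in> T. (i, r) \<in> G\<^sup>*}"
    obtain k l where "k \<in> ?A" "l \<in> T - ?A" "adj l k"
      using cut[of ?A] i \<open>i \<in> T\<close> \<open>r \<in> T\<close> by blast
    then show False
      using converse_rtrancl_into_rtrancl[of l k G r] by (auto simp: G_def)
  qed
  have "d r = 0"
    unfolding d_def by (rule Least_eq_0) auto
  moreover have "\<exists>j. j \<in> T \<and> adj i j \<and> d j < d i" if i: "i \<in> T - {r}" for i
  proof -
    have "\<exists>k. (i, r) \<in> G ^^ k"
      using reach i rtrancl_power by blast
    then have di: "(i, r) \<in> G ^^ d i"
      unfolding d_def by (meson LeastI_ex)
    then have "d i \<noteq> 0"
      using i by (metis DiffE relpow_0_E singletonI)
    then obtain k where k: "d i = Suc k"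
      using not0_implies_Suc by blast
    then obtain j where j: "(i, j) \<in> G" "(j, r) \<in> G ^^ k"
      using di by (metis relpow_Suc_D2)
    then have "d j \<le> k"
      unfolding d_def by (simp add: Least_le)
    then show ?thesis using j k unfolding G_def by auto
  qed
  ultimately show ?thesis by metis
qed

text \<open>Induction on the depth. If \<open>{i, p i}\<close> is not the \<open>q\<close>-edge of
  \<open>i\<close>, it is that of \<open>p i\<close>, so \<open>q (p i) = i\<close>. By induction
  \<open>q (p i) = p (p i)\<close>, and \<open>i\<close> would be its own grandparent, against the
  depth. In the application \<open>q\<close> is read off a matching and brings no depth of its
  own.\<close>

lemma parent_unique:
  fixes d :: "'a \<Rightarrow> nat"
  assumes p: "\<And>i. i \<in> T - {r} \<Longrightarrow> p i \<in> T \<and> d (p i) < d i"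
    and q: "\<And>i. i \<in> T - {r} \<Longrightarrow> \<exists>j\<in>T - {r}. {i, p i} = {j, q j}"
    and "i \<in> T - {r}"
  shows "q i = p i"
  using \<open>i \<in> T - {r}\<close>
proof (induction "d i" arbitrary: i rule: less_induct)
  case less
  obtain j where j: "j \<in> T - {r}" "{i, p i} = {j, q j}"
    using q less.prems by blast
  show ?case
  proof (cases "j = i")
    case True
    then show ?thesis using j by (metis doubleton_eq_iff)
  next
    case False
    then have ji: "j = p i" "q j = i"
      using j by (auto simp: doubleton_eq_iff)
    then have "q j = p j"
      using less.hyps[of j] p[OF less.prems] j by blast
    then show ?thesis
      using ji p[OF less.prems] p[OF j(1)] by simp
  qed
qed

section \<open>The simplex, its facets and ridges\<close>

text \<open>With at least four vertices in \<open>T\<close>, a ridge has at least two. So a critical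
  vertex is never counted among the critical ridges, and edges belong to the skeleton.\<close>

locale simplex =
  fixes T :: "'a set"
  assumes finite_T: "finite T" and card_T: "card T \<ge> 4"
begin

definition full :: "'a set set" where
  "full = {X. X \<subseteq> T \<and> X \<noteq> {}}"

text \<open>Codimension at least two, written additively so that no subtraction of naturals can
  truncate.\<close>

definition skel :: "'a set set" where
  "skel = {X \<in> full. card X + 2 \<le> card T}"

lemma finite_full [simp]: "finite full"
  unfolding full_def using finite_T by simp

lemma finite_skel [simp]: "finite skel"
  unfolding skel_def by simp

lemma skel_subset_full: "skel \<subseteq> full"
  unfolding skel_def by auto

lemma card_facet: "i \<in> T \<Longrightarrow> card (T - {i}) + 1 = card T"
  using finite_T card_T by simp

lemma card_ridge: "i \<in> T \<Longrightarrow> j \<in> T \<Longrightarrow> i \<noteq> j \<Longrightarrow> card (T - {i, j}) + 2 = card T"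
  using finite_T card_T by (simp add: card_Diff_subset)

lemma ridge_eqD:
  assumes "T - {i, j} = T - {k, l}" "i \<in> T" "j \<in> T" "k \<in> T" "l \<in> T"
  shows "{i, j} = {k, l}"
  using assms by blast

lemma facet_in:
  assumes "i \<in> T"
  shows "T - {i} \<in> full - skel"
proof -
  have c: "card (T - {i}) + 1 = card T" by (rule card_facet[OF assms])
  then have "card (T - {i}) \<noteq> 0" using card_T by linarith
  then have "T - {i} \<noteq> {}" by (metis card.empty)
  then have "T - {i} \<in> full" unfolding full_def by blast
  moreover have "\<not> card (T - {i}) + 2 \<le> card T" using c by linarith
  ultimately show ?thesis unfolding skel_def by simp
qed

lemma top_in: "T \<in> full - skel"
  using card_T unfolding full_def skel_def by auto

lemma ridge_in:
  assumes "i \<in> T" "j \<in> T" "i \<noteq> j"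
  shows "T - {i, j} \<in> skel"
proof -
  have c: "card (T - {i, j}) + 2 = card T" by (rule card_ridge[OF assms])
  then have "card (T - {i, j}) \<noteq> 0" using card_T by linarith
  then have "T - {i, j} \<noteq> {}" by (metis card.empty)
  then show ?thesis using c unfolding full_def skel_def by simp
qed

lemma facet_cases:
  assumes "X \<subseteq> T" "card X + 1 = card T"
  obtains i where "i \<in> T" "X = T - {i}"
proof -
  have "card (T - X) = 1"
    using assms finite_T by (simp add: card_Diff_subset finite_subset)
  then obtain i where "T - X = {i}" by (rule card_1_singletonE)
  then show ?thesis using that[of i] assms by blast
qed

lemma ridge_cases:
  assumes "X \<subseteq> T" "card X + 2 = card T"
  obtains i j where "i \<in> T" "j \<in> T" "i \<noteq> j" "X = T - {i, j}"
proof -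
  have "card (T - X) = 2"
    using assms finite_T by (simp add: card_Diff_subset finite_subset)
  then obtain i j where "T - X = {i, j}" "i \<noteq> j" by (meson card_2_iff)
  then show ?thesis using that[of i j] assms by blast
qed

lemma not_skel_cases:
  assumes "X \<in> full - skel"
  obtains "X = T" | i where "i \<in> T" "X = T - {i}"
proof -
  have X: "X \<subseteq> T" "card X + 2 > card T" using assms unfolding full_def skel_def by auto
  then have "card X = card T \<or> card X + 1 = card T"
    using card_mono[OF finite_T X(1)] by linarith
  then show ?thesis
    using that X facet_cases card_subset_eq[OF finite_T X(1)] by metis
qed

section \<open>Critical vertices and the cone matching\<close>

lemma critical_vertex_full:
  assumes "acyclic_matching full V"
  shows "\<exists>v. {v} \<in> critical full V"
proof -
  obtain a where "a \<in> T" using card_T by fastforce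
  then show ?thesis
    using assms by (intro acyclic_matching_critical_vertex[of _ _ a]) (auto simp: full_def finite_T)
qed

lemma critical_vertex_skel:
  assumes "acyclic_matching skel W"
  shows "\<exists>v. {v} \<in> critical skel W"
proof -
  obtain a where "a \<in> T" using card_T by fastforce
  then show ?thesis
    using assms card_T
    by (intro acyclic_matching_critical_vertex[of _ _ a]) (auto simp: full_def skel_def finite_T)
qed

text \<open>Every simplex is paired by adding or removing an apex \<open>a\<close>, except
  \<open>{a}\<close>, whose partner would be the empty set. So one critical simplex is
  attainable.\<close>

lemma cone_matching:
  "\<exists>V. acyclic_matching full V \<and> card (critical full V) = 1"
proof -
  obtain a where a: "a \<in> T" using card_T by fastforce
  define V where "V = {(X, insert a X) | X. X \<in> full \<and> a \<notin> X}"
  have fin: "finite X" if "X \<in> full" for X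
    using that finite_T finite_subset unfolding full_def by blast
  have "(X, insert a X) \<in> hasse_edges full" if "X \<in> full" "a \<notin> X" for X
    using that fin[of X] a unfolding hasse_edges_def by (auto simp: full_def)
  then have "V \<subseteq> hasse_edges full"
    unfolding V_def by blast
  moreover have "e = e'" if ee: "e \<in> V" "e' \<in> V" "{fst e, snd e} \<inter> {fst e', snd e'} \<noteq> {}" for e e'
  proof -
    obtain X X' where "a \<notin> X" "a \<notin> X'" "e = (X, insert a X)" "e' = (X', insert a X')"
      using ee(1,2) unfolding V_def by blast
    then show ?thesis using ee(3) insert_ident[of a X X'] by auto
  qed
  ultimately have "is_matching full V"
    unfolding is_matching_def by blast
  moreover have "acyclic (morse_graph full V)"
  proof (rule acyclic_by_closed_set[where D = UNIV and S = "{}"])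
    \<comment> \<open>With \<open>D = UNIV\<close> the criterion is a pure potential argument.
      Unpaired edges keep the membership of \<open>a\<close> and enlarge the simplex; reversed edges
      lose \<open>a\<close>, and the offset \<open>card T + 1\<close> places every simplex with
      \<open>a\<close> above all those without it.\<close>
    let ?f = "\<lambda>X. if a \<in> X then 2 * card T + 1 - card X else card T - card X"
    fix X Y assume XY: "(X, Y) \<in> morse_graph full V"
    have le: "card Z \<le> card T" if "Z \<in> full" for Z
      using that finite_T card_mono unfolding full_def by blast
    have "?f Y < ?f X"
    proof (cases "(Y, X) \<in> V")
      case True
      then have "a \<in> X" "a \<notin> Y" "X \<in> full" "Y \<in> full"
        using a unfolding V_def full_def by auto
      then show ?thesis using le[of X] le[of Y] by simp
    next
      case False
      then have h: "X \<in> full" "Y \<in> full" "X \<subset> Y" "card Y = card X + 1" and n: "(X, Y) \<notin> V"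
        using XY unfolding hasse_edges_def by auto
      have "a \<in> X" if "a \<in> Y"
      proof (rule ccontr)
        assume "a \<notin> X"
        then have "insert a X \<subseteq> Y" "card (insert a X) = card Y"
          using that h fin[of X] by auto
        then have "insert a X = Y"
          using fin[of Y] h by (simp add: card_subset_eq)
        then show False using n \<open>a \<notin> X\<close> h unfolding V_def by blast
      qed
      then have "a \<in> Y \<longleftrightarrow> a \<in> X" using h by auto
      then show ?thesis using le[of X] le[of Y] h by auto
    qed
    then show "Y \<in> UNIV \<and> ?f Y < ?f X" by simp
  qed (auto simp: acyclic_def)
  moreover have "critical full V = {{a}}"
  proof
    have "X \<in> fst ` V \<union> snd ` V" if "X \<in> full" "X \<noteq> {a}" for X
    proof (cases "a \<in> X")
      case True
      then have "(X - {a}, X) \<in> V"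
        unfolding V_def using that by (auto simp: full_def insert_absorb intro!: exI[of _ "X - {a}"])
      then show ?thesis by force
    next
      case False
      then have "(X, insert a X) \<in> V" unfolding V_def using that by auto
      then show ?thesis by force
    qed
    then show "critical full V \<subseteq> {{a}}" unfolding critical_def by blast
    show "{{a}} \<subseteq> critical full V"
      using a unfolding critical_def V_def full_def by (auto dest: sym)
  qed
  ultimately show ?thesis
    unfolding acyclic_matching_def by (intro exI[of _ V]) simp
qed

section \<open>Critical ridges on the skeleton and the lower bound\<close>

text \<open>The ridges dual to a cut form a cycle modulo 2: each of their codimension-one faces lies in a
  second one.  If all of them were matched downwards, one could walk along the matching forever.\<close>

lemma critical_ridge_crosses_cut:
  assumes W: "acyclic_matching skel W" and A: "A \<subseteq> T" "A \<noteq> {}" "A \<noteq> T"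
  shows "\<exists>i\<in>A. \<exists>j\<in>T - A. T - {i, j} \<in> critical skel W"
proof (rule ccontr)
  assume none: "\<not> ?thesis"
  have M: "is_matching skel W" and ac: "acyclic (morse_graph skel W)"
    using W by (auto simp: acyclic_matching_def)
  let ?Z = "{T - {i, j} | i j. i \<in> A \<and> j \<in> T - A}"
  have "?Z \<subseteq> Pow T" by auto
  then have fin: "finite ?Z" using finite_T by (meson finite_Pow_iff finite_subset)
  have "\<exists>Y\<in>?Z. (X, Y) \<in> (morse_graph skel W)\<^sup>+" if XZ: "X \<in> ?Z" for X
  proof -
    obtain i j where ij: "i \<in> A" "j \<in> T - A" "X = T - {i, j}"
      using XZ by blast
    then have T: "i \<in> T" "j \<in> T" "i \<noteq> j" using A by auto
    have X: "X \<in> skel" "card X + 2 = card T"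
      using ridge_in[OF T] card_ridge[OF T] ij by auto
    have "\<nexists>Y. (X, Y) \<in> W"
    proof
      assume "\<exists>Y. (X, Y) \<in> W"
      then obtain Y where "Y \<in> skel" "card Y = card X + 1" using matching_edge[OF M] by blast
      then show False using X unfolding skel_def by auto
    qed
    moreover have "X \<notin> critical skel W" using none ij by blast
    then have "X \<in> fst ` W \<union> snd ` W" using X(1) unfolding critical_def by blast
    ultimately obtain Y where Y: "(Y, X) \<in> W" by auto
    have YX: "Y \<in> skel" "Y \<subset> X" "card X = card Y + 1"
      using matching_edge[OF M Y] by auto
    then obtain k where k: "k \<in> X" "k \<notin> Y" by blast
    \<comment> \<open>Here \<open>Y\<close> is \<open>T - {i, j, k}\<close>. Of its two further
      ridges, exactly one crosses the cut: \<open>k\<close> replaces whichever of \<open>i\<close>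
      and \<open>j\<close> lies on its own side.\<close>
    define Z where "Z = (if k \<in> A then T - {k, j} else T - {i, k})"
    have kT: "k \<in> T" "k \<noteq> i" "k \<noteq> j" using k ij by auto
    have "Z \<in> ?Z" using ij kT unfolding Z_def by (cases "k \<in> A") auto
    have Z: "Z \<in> skel" "card Z = card X"
      using ridge_in[of k j] ridge_in[of i k] card_ridge[of k j] card_ridge[of i k] T kT X
      unfolding Z_def by auto
    have "Y \<subseteq> Z" using YX k ij unfolding Z_def by auto
    moreover have "Y \<noteq> Z" using Z YX by auto
    ultimately have "(Y, Z) \<in> hasse_edges skel"
      using YX Z unfolding hasse_edges_def by auto
    moreover have "Z \<noteq> X" using kT T ij k unfolding Z_def by auto
    then have "(Y, Z) \<notin> W" using matching_pair_unique[OF M Y] by blast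
    ultimately have "(X, Y) \<in> morse_graph skel W" "(Y, Z) \<in> morse_graph skel W"
      using Y by auto
    then have "(X, Z) \<in> (morse_graph skel W)\<^sup>+"
      by (meson r_into_trancl' trancl_into_trancl)
    then show ?thesis using \<open>Z \<in> ?Z\<close> by blast
  qed
  moreover have "?Z \<noteq> {}" using A by blast
  ultimately show False
    using acyclic_finite_has_sink[OF ac fin] by blast
qed

text \<open>A rooted spanning tree of critical ridges. Any depth decreasing towards the root will
  do; the value zero at the root calibrates it for the potential that proves extensions
  acyclic.\<close>

definition parents :: "('a set \<times> 'a set) set \<Rightarrow> 'a \<Rightarrow> ('a \<Rightarrow> 'a) \<Rightarrow> ('a \<Rightarrow> nat) \<Rightarrow> bool" where
  "parents W r p d \<longleftrightarrow> d r = 0 \<and>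
     (\<forall>i\<in>T - {r}. p i \<in> T \<and> T - {i, p i} \<in> critical skel W \<and> d (p i) < d i)"

lemma parents_exist:
  assumes "acyclic_matching skel W" "r \<in> T"
  shows "\<exists>p d. parents W r p d"
  unfolding parents_def
proof (rule parents_if_cuts_crossed[OF \<open>r \<in> T\<close>])
  fix A assume "A \<subseteq> T" "r \<in> A" "A \<noteq> T"
  then show "\<exists>i\<in>A. \<exists>j\<in>T - A. T - {j, i} \<in> critical skel W"
    using critical_ridge_crosses_cut[OF assms(1), of A] by (metis empty_iff insert_commute)
qed

definition ridges :: "'a \<Rightarrow> ('a \<Rightarrow> 'a) \<Rightarrow> 'a set set" where
  "ridges r p = (\<lambda>i. T - {i, p i}) ` (T - {r})"

lemma parentsD:
  assumes "parents W r p d" "i \<in> T - {r}"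
  shows "p i \<in> T" "p i \<noteq> i" "T - {i, p i} \<in> critical skel W" "d (p i) < d i"
proof -
  show 1: "p i \<in> T" "T - {i, p i} \<in> critical skel W" "d (p i) < d i"
    using assms unfolding parents_def by blast+
  show "p i \<noteq> i" using 1(3) by auto
qed

text \<open>Two vertices with the same tree edge would be parents of each other, against the depth.
  Hence the tree has one edge for each vertex other than the root.\<close>

lemma parents_inj:
  assumes "parents W r p d"
  shows "inj_on (\<lambda>i. T - {i, p i}) (T - {r})"
proof (rule inj_onI)
  fix i j assume ij: "i \<in> T - {r}" "j \<in> T - {r}" "T - {i, p i} = T - {j, p j}"
  then have "{i, p i} = {j, p j}"
    using parentsD(1)[OF assms] ridge_eqD by (metis DiffE)
  then show "i = j"
    using parentsD(4)[OF assms ij(1)] parentsD(4)[OF assms ij(2)] by (auto simp: doubleton_eq_iff)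
qed

lemma card_ridges:
  assumes "parents W r p d" "r \<in> T"
  shows "card (ridges r p) + 1 = card T"
  using card_image[OF parents_inj[OF assms(1)]] card_facet[OF assms(2)]
  by (simp add: ridges_def)

lemma ridges_critical:
  assumes "parents W r p d"
  shows "ridges r p \<subseteq> {X \<in> critical skel W. card X + 2 = card T}"
proof -
  have "card (T - {i, p i}) + 2 = card T" if "i \<in> T - {r}" for i
    using card_ridge[of i "p i"] parentsD[OF assms that] that by simp
  then show ?thesis
    using parentsD(3)[OF assms] unfolding ridges_def by blast
qed

text \<open>A spanning tree supplies \<open>card T - 1\<close> critical ridges, and the critical
  vertex adds one more simplex since it is no ridge.\<close>

lemma card_critical_skel_ge:
  assumes W: "acyclic_matching skel W"
  shows "card {X \<in> critical skel W. card X + 2 = card T} + 1 \<le> card (critical skel W)"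
    and "card T \<le> card {X \<in> critical skel W. card X + 2 = card T} + 1"
proof -
  let ?C = "{X \<in> critical skel W. card X + 2 = card T}"
  have fin: "finite (critical skel W)" unfolding critical_def by simp
  obtain v where v: "{v} \<in> critical skel W" using critical_vertex_skel[OF W] by blast
  have "insert {v} ?C \<subseteq> critical skel W" "{v} \<notin> ?C" using v card_T by auto
  then show "card ?C + 1 \<le> card (critical skel W)"
    using fin by (metis (no_types, lifting) Suc_eq_plus1 card_insert_disjoint card_mono finite_insert finite_subset)
  obtain r where "r \<in> T" using card_T by fastforce
  then obtain p d where "parents W r p d" using parents_exist[OF W] by blast
  then show "card T \<le> card ?C + 1"
    using card_ridges[OF _ \<open>r \<in> T\<close>] card_mono[OF _ ridges_critical] fin
    by (metis (no_types, lifting) add_le_mono1 finite_subset mem_Collect_eq subsetI)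
qed

lemma optimal_full_iff:
  "V \<in> optimal_matchings full \<longleftrightarrow> acyclic_matching full V \<and> card (critical full V) = 1"
proof -
  have "1 \<le> card (critical full V)" if "acyclic_matching full V" for V
    using critical_vertex_full[OF that] card_gt_0_iff[of "critical full V"]
    unfolding critical_def by fastforce
  then show ?thesis
    using cone_matching optimal_matchings_iff by metis
qed

lemma optimal_full_critical:
  assumes "V \<in> optimal_matchings full"
  obtains v where "critical full V = {{v}}"
  using assms critical_vertex_full unfolding optimal_full_iff
  by (metis card_1_singletonE singletonD)

section \<open>Extending a skeleton matching along a rooted tree\<close>

definition extend :: "('a set \<times> 'a set) set \<Rightarrow> 'a \<Rightarrow> ('a \<Rightarrow> 'a) \<Rightarrow> ('a set \<times> 'a set) set" where
  "extend W r p = W \<union> {(T - {r}, T)} \<union> (\<lambda>i. (T - {i, p i}, T - {i})) ` (T - {r})"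

lemma extend_cases:
  assumes "(X, Y) \<in> extend W r p"
  obtains "(X, Y) \<in> W" | "X = T - {r}" "Y = T"
    | i where "i \<in> T - {r}" "X = T - {i, p i}" "Y = T - {i}"
  using assms unfolding extend_def by blast

text \<open>The new pairs touch only the top face, facets and critical ridges, so they avoid
  \<open>W\<close>; among themselves they are disjoint because distinct vertices have distinct tree
  edges.\<close>

lemma extend_matching:
  assumes W: "acyclic_matching skel W" and r: "r \<in> T" and p: "parents W r p d"
  shows "is_matching full (extend W r p)"
proof -
  have M: "is_matching skel W" using W by (simp add: acyclic_matching_def)
  have W_edge: "X \<in> skel" "Y \<in> skel" "X \<notin> ridges r p" "Y \<notin> ridges r p" if "(X, Y) \<in> W" for X Y
    using matching_edge[OF M that] that ridges_critical[OF p] unfolding critical_def by force+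
  have rr: "i \<in> T - {r} \<Longrightarrow> T - {i, p i} \<in> skel" for i
    using ridge_in[of i "p i"] parentsD[OF p, of i] by auto
  have "(X, Y) \<in> hasse_edges full" if "(X, Y) \<in> extend W r p" for X Y
    using that
  proof (cases rule: extend_cases)
    case 1
    then show ?thesis using matching_edge[OF M] skel_subset_full unfolding hasse_edges_def by auto
  next
    case 2
    then show ?thesis using r facet_in top_in card_facet unfolding hasse_edges_def by auto
  next
    case (3 i)
    then have "card X + 2 = card T" "card Y + 1 = card T"
      using card_facet[of i] card_ridge[of i "p i"] parentsD[OF p, of i] by auto
    moreover have "X \<subseteq> Y" "X \<in> full" "Y \<in> full"
      using 3 rr[of i] facet_in[of i] skel_subset_full by auto
    ultimately show ?thesis unfolding hasse_edges_def by auto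
  qed
  moreover have "X = X' \<and> Y = Y'"
    if e: "(X, Y) \<in> extend W r p" and e': "(X', Y') \<in> extend W r p"
      and meet: "X = X' \<or> X = Y' \<or> Y = X' \<or> Y = Y'" for X Y X' Y'
  proof -
    \<comment> \<open>The ends of pairs are sorted into skeleton simplices off the tree, tree
      ridges, facets and the top face; pairs of different kinds can then share no end, except a
      facet, which determines its vertex.\<close>
    have kind: "(X, Y) \<in> W \<and> X \<in> skel - ridges r p \<and> Y \<in> skel - ridges r p
        \<or> X = T - {r} \<and> Y = T \<or> (\<exists>i\<in>T - {r}. X = T - {i, p i} \<and> Y = T - {i})"
      if "(X, Y) \<in> extend W r p" for X Y
      using that W_edge by (cases rule: extend_cases) auto
    have inj: "i = j" if "i \<in> T - {r}" "j \<in> T - {r}" "T - {i, p i} = T - {j, p j}" for i j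
      using parents_inj[OF p] that by (auto dest: inj_onD)
    have rdg: "T - {i, p i} \<in> skel \<inter> ridges r p" if "i \<in> T - {r}" for i
      using that rr unfolding ridges_def by auto
    have fct: "T - {i} \<notin> skel" "T - {i} \<noteq> T" if "i \<in> T" for i
      using that facet_in by auto
    have top: "T \<notin> skel" using top_in by auto
    have finj: "i = j" if "i \<in> T" "j \<in> T" "T - {i} = T - {j}" for i j
      using that by blast
    show ?thesis
      using kind[OF e]
    proof (elim disjE conjE bexE)
      assume XY: "(X, Y) \<in> W" "X \<in> skel - ridges r p" "Y \<in> skel - ridges r p"
      show ?thesis
        using kind[OF e']
      proof (elim disjE conjE bexE)
        assume "(X', Y') \<in> W"
        then show ?thesis using matching_pair_unique[OF M XY(1)] meet by blast
      qed (use XY meet rdg fct top r in \<open>auto simp del: Diff_insert\<close>)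
    next
      assume XY: "X = T - {r}" "Y = T"
      show ?thesis
        using kind[OF e']
      proof (elim disjE conjE bexE)
        fix j assume j: "j \<in> T - {r}" "X' = T - {j, p j}" "Y' = T - {j}"
        have "X' \<in> skel" "Y' \<noteq> T" "Y' \<noteq> T - {r}"
          using rdg[OF j(1)] fct[of j] finj[of j r] j r by auto
        then show ?thesis using XY meet fct[OF r] top by auto
      qed (use XY meet fct top r in auto)
    next
      fix i assume i: "i \<in> T - {r}" "X = T - {i, p i}" "Y = T - {i}"
      have XY: "X \<in> skel" "X \<in> ridges r p" "Y \<notin> skel" "Y \<noteq> T" "Y \<noteq> T - {r}"
        using rdg[OF i(1)] fct[of i] finj[of i r] i r by auto
      show ?thesis
        using kind[OF e']
      proof (elim disjE conjE bexE)
        fix j assume j: "j \<in> T - {r}" "X' = T - {j, p j}" "Y' = T - {j}"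
        have "X' \<in> skel" "Y' \<notin> skel"
          using rdg[OF j(1)] fct[of j] j by auto
        then have "X = X' \<or> Y = Y'" using XY meet by auto
        then have "i = j" using i j inj[of i j] finj[of i j] by auto
        then show ?thesis using i j by simp
      qed (use XY meet fct top r in auto)
    qed
  qed
  ultimately show ?thesis
    by (rule is_matchingI)
qed

lemma extend_acyclic:
  assumes W: "acyclic_matching skel W" and r: "r \<in> T" and p: "parents W r p d"
  shows "acyclic (morse_graph full (extend W r p))"
proof -
  have M: "is_matching skel W" and ac: "acyclic (morse_graph skel W)"
    using W by (auto simp: acyclic_matching_def)
  have E: "is_matching full (extend W r p)" by (rule extend_matching[OF assms])
  \<comment> \<open>From \<open>D\<close> one never returns to the rest of the skeleton: paths in \<open>D\<close> move towards the root,
    or over the top face directly to the root facet.\<close>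
  define D where "D = (full - skel) \<union> ridges r p"
  \<comment> \<open>The values are \<open>2 * d i + 1\<close> on the facet \<open>T - {i}\<close>
    and \<open>2 * d i\<close> on the ridge \<open>T - {i, p i}\<close>, whose maximum is the depth
    of the child. They fall along facet, ridge, parent facet. The value 2 of \<open>T\<close> lies
    between 1 for the root facet and at least 3 for all others.\<close>
  define f where "f X = (if X = T then 2 else 2 * Max (d ` (T - X)) + (2 - card (T - X)))" for X
  have fT: "f T = 2" unfolding f_def by simp
  have fF: "f (T - {i}) = 2 * d i + 1" if "i \<in> T" for i
  proof -
    have "T - (T - {i}) = {i}" using that by blast
    then show ?thesis using that unfolding f_def by auto
  qed
  have fR: "f (T - {i, p i}) = 2 * d i" if "i \<in> T - {r}" for i
  proof -
    have "T - (T - {i, p i}) = {i, p i}" "T - {i, p i} \<noteq> T"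
      using that parentsD[OF p that] by auto
    then show ?thesis using parentsD[OF p that] unfolding f_def by (simp del: Diff_insert)
  qed
  show ?thesis
  proof (rule acyclic_by_closed_set[where D = D and f = f, OF _ _ ac])
    fix X Y assume XY: "(X, Y) \<in> morse_graph full (extend W r p)" and X: "X \<in> D"
    show "Y \<in> D \<and> f Y < f X"
    proof (cases "(Y, X) \<in> extend W r p")
      case True
      then show ?thesis
      proof (cases rule: extend_cases)
        case 1
        \<comment> \<open>\<open>X\<close> is the upper end of a pair of \<open>W\<close>, whereas
          the members of \<open>D\<close> inside the skeleton are critical: no reversed pair of
          \<open>W\<close> leads out of \<open>D\<close>.\<close>
        then have "X \<in> skel" "X \<notin> critical skel W"
          using matching_edge(2)[OF M 1] 1 critical_iff by blast+
        then show ?thesis using X ridges_critical[OF p] unfolding D_def by blast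
      next
        case 2
        then show ?thesis using fT fF[OF r] p facet_in[OF r] unfolding D_def parents_def by auto
      next
        case (3 i)
        then show ?thesis using fF[of i] fR[of i] unfolding D_def ridges_def by auto
      qed
    next
      case False
      then have h: "X \<in> full" "Y \<in> full" "X \<subset> Y" "card Y = card X + 1"
        and n: "(X, Y) \<notin> extend W r p"
        using XY unfolding hasse_edges_def by auto
      have YT: "Y \<subseteq> T" using h unfolding full_def by auto
      consider "X = T" | i where "i \<in> T" "X = T - {i}"
        | i where "i \<in> T - {r}" "X = T - {i, p i}"
        using X not_skel_cases[of X] unfolding D_def ridges_def by blast
      then show ?thesis
      proof cases
        case 1
        then show ?thesis using YT h by auto
      next
        case (2 i)
        then have "Y = T" using YT h by blast
        then have "i \<in> T - {r}" using 2 n unfolding extend_def by auto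
        then have "0 < d i" using parentsD(4)[OF p, of i] by auto
        then show ?thesis using \<open>Y = T\<close> 2 fT fF[of i] top_in unfolding D_def by auto
      next
        case (3 i)
        have pi: "p i \<in> T" "p i \<noteq> i" "d (p i) < d i" using parentsD[OF p 3(1)] by auto
        have "card X + 2 = card T" using card_ridge[of i "p i"] pi 3 by auto
        then obtain j where j: "j \<in> T" "Y = T - {j}"
          using h YT facet_cases[of Y] by auto
        have "j \<in> {i, p i}" using j 3 h by blast
        \<comment> \<open>The edge up to \<open>T - {i}\<close> is a pair and hence reversed, which
          leaves only the parent facet.\<close>
        moreover have "j \<noteq> i" using j 3 n unfolding extend_def by auto
        ultimately have "Y = T - {p i}" using j by auto
        then show ?thesis using fF[OF pi(1)] fR[OF 3(1)] pi 3 facet_in[of "p i"] unfolding D_def by auto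
      qed
    qed
  next
    fix X Y assume XY: "(X, Y) \<in> morse_graph full (extend W r p)" and n: "X \<notin> D" "Y \<notin> D"
    have "X \<in> full" "Y \<in> full"
      using XY matching_edge[OF E] unfolding hasse_edges_def by auto
    then have sk: "X \<in> skel" "Y \<in> skel" using n unfolding D_def by auto
    show "(X, Y) \<in> morse_graph skel W"
    proof (cases "(Y, X) \<in> extend W r p")
      case True
      then have "(Y, X) \<in> W"
      proof (cases rule: extend_cases)
        case 2
        then show ?thesis using sk top_in by auto
      next
        case (3 i)
        then show ?thesis using sk facet_in[of i] by auto
      qed
      then show ?thesis by auto
    next
      case False
      then show ?thesis using XY sk unfolding hasse_edges_def extend_def by auto
    qed
  qed
qed

lemma extend_restrict:
  assumes W: "acyclic_matching skel W" and "r \<in> T"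
  shows "restrict_matching skel (extend W r p) = W"
proof -
  have M: "is_matching skel W" using W by (simp add: acyclic_matching_def)
  have "(X, Y) \<in> W" if "(X, Y) \<in> extend W r p" "Y \<in> skel" for X Y
    using that(1)
  proof (cases rule: extend_cases)
    case 2
    then show ?thesis using top_in that by auto
  next
    case (3 i)
    then show ?thesis using facet_in[of i] that by auto
  qed
  then have "restrict_matching skel (extend W r p) \<subseteq> W"
    unfolding restrict_matching_def by blast
  moreover have "(X, Y) \<in> restrict_matching skel (extend W r p)" if "(X, Y) \<in> W" for X Y
    using that matching_edge(1,2)[OF M that] unfolding restrict_matching_def extend_def by simp
  then have "W \<subseteq> restrict_matching skel (extend W r p)"
    by (rule subrelI)
  ultimately show ?thesis by blast
qed

lemma extend_critical:
  assumes "r \<in> T"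
  shows "critical full (extend W r p) \<subseteq> critical skel W - ridges r p"
proof
  fix X assume X: "X \<in> critical full (extend W r p)"
  then have n: "X \<in> full" "X \<notin> fst ` extend W r p" "X \<notin> snd ` extend W r p"
    unfolding critical_def by auto
  have "X \<in> skel"
  proof (rule ccontr)
    assume "X \<notin> skel"
    then consider "X = T" | i where "i \<in> T" "X = T - {i}"
      using n not_skel_cases[of X] by blast
    then show False
    proof cases
      case 1
      have "(T - {r}, T) \<in> extend W r p" unfolding extend_def by auto
      then show False using 1 n by force
    next
      case (2 i)
      have "(T - {r}, T) \<in> extend W r p" "i \<noteq> r \<Longrightarrow> (T - {i, p i}, T - {i}) \<in> extend W r p"
        using 2 unfolding extend_def by auto
      then show False using 2 n by (cases "i = r") force+
    qed
  qed
  moreover have "ridges r p \<subseteq> fst ` extend W r p" "fst ` W \<subseteq> fst ` extend W r p"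
      "snd ` W \<subseteq> snd ` extend W r p"
    unfolding extend_def ridges_def by (auto simp: image_Un image_image)
  then have "X \<notin> fst ` W" "X \<notin> snd ` W" "X \<notin> ridges r p"
    using n by blast+
  ultimately show "X \<in> critical skel W - ridges r p" unfolding critical_def by auto
qed

section \<open>Restricting a matching to the skeleton\<close>

lemma restrict_acyclic:
  assumes V: "acyclic_matching full V"
  shows "acyclic_matching skel (restrict_matching skel V)"
proof -
  let ?W = "restrict_matching skel V"
  have M: "is_matching full V" and ac: "acyclic (morse_graph full V)"
    using V by (auto simp: acyclic_matching_def)
  have "is_matching skel ?W"
  proof (rule is_matchingI)
    show "(a, b) \<in> hasse_edges skel" if "(a, b) \<in> ?W" for a b
      using that matching_edge[OF M, of a b] unfolding restrict_matching_def hasse_edges_def by auto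
    show "a = c \<and> b = d" if e: "(a, b) \<in> ?W" "(c, d) \<in> ?W" "a = c \<or> a = d \<or> b = c \<or> b = d"
      for a b c d
    proof (rule matching_pair_unique[OF M])
      show "(a, b) \<in> V" "(c, d) \<in> V" using e unfolding restrict_matching_def by auto
    qed (use e(3) in blast)
  qed
  moreover have "morse_graph skel ?W \<subseteq> morse_graph full V"
    using skel_subset_full unfolding restrict_matching_def hasse_edges_def by auto
  ultimately show ?thesis
    unfolding acyclic_matching_def using ac acyclic_subset by blast
qed

text \<open>This inverts \<open>extend\<close>. Facets cannot be critical, and once \<open>T\<close>
  is taken by one of them the others can only be matched downwards. The map \<open>q\<close> is not
  yet known to be a parent map; that follows later by comparison with a tree of critical
  ridges.\<close>

lemma optimal_full_structure:
  assumes V: "V \<in> optimal_matchings full"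
  obtains r q v where "r \<in> T" "V = extend (restrict_matching skel V) r q"
    "\<And>i. i \<in> T - {r} \<Longrightarrow> q i \<in> T - {i}"
    "critical skel (restrict_matching skel V) = insert {v} (ridges r q)"
    "card (ridges r q) + 1 = card T"
proof -
  let ?W = "restrict_matching skel V"
  have ac: "acyclic_matching full V" using V by (simp add: optimal_full_iff)
  then have M: "is_matching full V" by (simp add: acyclic_matching_def)
  obtain v where v: "critical full V = {{v}}" using optimal_full_critical[OF V] .
  have matched: "(\<exists>Y. (X, Y) \<in> V) \<or> (\<exists>Y. (Y, X) \<in> V)" if "X \<in> full" "card X + 2 > card T" for X
  proof -
    have "X \<notin> critical full V" using v that card_T by auto
    then show ?thesis using that unfolding critical_def by force
  qed
  have "\<nexists>Y. (T, Y) \<in> V"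
    using matching_edge[OF M, of T] unfolding full_def by blast
  then obtain F where F: "(F, T) \<in> V" using matched[of T] top_in by auto
  then obtain r where r: "r \<in> T" "F = T - {r}"
    using matching_edge[OF M F] facet_cases[of F] by auto
  have "\<exists>j\<in>T - {i}. (T - {i, j}, T - {i}) \<in> V" if i: "i \<in> T - {r}" for i
  proof -
    have cF: "T - {i} \<in> full" "card (T - {i}) + 1 = card T"
      using facet_in[of i] card_facet[of i] i by auto
    have "(T - {i}, Y) \<notin> V" for Y
    proof
      assume Y: "(T - {i}, Y) \<in> V"
      have "Y \<subseteq> T" "T - {i} \<subset> Y" using matching_edge[OF M Y] unfolding full_def by auto
      then have "Y = T" by blast
      then show False using matching_pair_unique[OF M Y F] r i by blast
    qed
    then obtain X where X: "(X, T - {i}) \<in> V" using matched[OF cF(1)] cF by auto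
    have XX: "X \<subset> T - {i}" "card X + 2 = card T" using matching_edge[OF M X] cF by auto
    then obtain k l where "k \<in> T" "l \<in> T" "k \<noteq> l" "X = T - {k, l}" using ridge_cases[of X] by auto
    moreover from this have "i = k \<or> i = l" using XX i by auto
    ultimately show ?thesis using X i by (metis DiffI insert_commute singletonD)
  qed
  then obtain q where q: "\<And>i. i \<in> T - {r} \<Longrightarrow> q i \<in> T - {i} \<and> (T - {i, q i}, T - {i}) \<in> V"
    by metis
  have Vq: "V = extend ?W r q"
  proof
    show "extend ?W r q \<subseteq> V"
      using F r q unfolding extend_def restrict_matching_def by auto
    show "V \<subseteq> extend ?W r q"
    proof (rule subrelI)
      fix X Y assume XY: "(X, Y) \<in> V"
      note e = matching_edge[OF M XY]
      show "(X, Y) \<in> extend ?W r q"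
      proof (cases "Y \<in> skel")
        case True
        then have "X \<in> skel" using e unfolding skel_def by auto
        then show ?thesis using True XY unfolding extend_def restrict_matching_def by auto
      next
        case False
        then consider "Y = T" | i where "i \<in> T" "Y = T - {i}"
          using e not_skel_cases[of Y] by blast
        then show ?thesis
        proof cases
          case 1
          then have "X = T - {r}" using matching_pair_unique[OF M XY F] r by blast
          then show ?thesis using 1 unfolding extend_def by auto
        next
          case (2 i)
          show ?thesis
          proof (cases "i = r")
            case True
            then have "X = T - {r} \<and> Y = T" using matching_pair_unique[OF M XY F] r 2 by blast
            then show ?thesis unfolding extend_def by auto
          next
            case False
            then have "X = T - {i, q i}" using matching_pair_unique[OF M XY, of "T - {i, q i}" "T - {i}"] q[of i] 2 by blast
            then show ?thesis using 2 False unfolding extend_def by auto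
          qed
        qed
      qed
    qed
  qed
  have "T - {i, q i} \<in> skel" if "i \<in> T - {r}" for i
    using ridge_in[of i "q i"] q[OF that] that by auto
  then have rsk: "ridges r q \<subseteq> skel"
    unfolding ridges_def by blast
  have vV: "{v} \<in> critical full V" using v by simp
  have vsk: "{v} \<in> skel"
    using vV card_T unfolding critical_iff skel_def by simp
  have VD: "(X, Y) \<in> extend ?W r q" if "(X, Y) \<in> V" for X Y
    using that equalityD1[OF Vq] by blast
  have crit: "critical skel ?W = insert {v} (ridges r q)"
  proof
    show "critical skel ?W \<subseteq> insert {v} (ridges r q)"
    proof
      fix X assume X: "X \<in> critical skel ?W"
      then have Xs: "X \<in> skel" and nW: "(X, Y) \<notin> ?W" "(Y, X) \<notin> ?W" for Y
        by (auto simp: critical_iff)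
      show "X \<in> insert {v} (ridges r q)"
      proof (cases "X = {v}")
        case False
        then have "X \<notin> critical full V" using v by simp
        moreover have "X \<in> full" using Xs skel_subset_full by blast
        ultimately obtain Y where "(X, Y) \<in> V \<or> (Y, X) \<in> V" by (auto simp: critical_iff)
        then have "X = T - {r} \<or> X = T \<or> (\<exists>i\<in>T - {r}. X = T - {i, q i} \<or> X = T - {i})"
        proof
          assume "(X, Y) \<in> V"
          from VD[OF this] show ?thesis by (cases rule: extend_cases) (use nW in auto)
        next
          assume "(Y, X) \<in> V"
          from VD[OF this] show ?thesis by (cases rule: extend_cases) (use nW in auto)
        qed
        then show ?thesis using Xs top_in facet_in r(1) unfolding ridges_def by blast
      qed simp
    qed
    \<comment> \<open>The partner of such a ridge is a facet outside the skeleton, so restriction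
      destroys the pair and leaves the ridge critical.\<close>
    have "X \<in> critical skel ?W" if X: "X \<in> ridges r q" for X
    proof -
      have Xs: "X \<in> skel" using X rsk by blast
      obtain i where i: "i \<in> T - {r}" "X = T - {i, q i}" using X unfolding ridges_def by blast
      then have e: "(X, T - {i}) \<in> V" using q[OF i(1)] by simp
      have Fs: "T - {i} \<notin> skel" using facet_in[of i] i by simp
      have "(X, Y) \<notin> ?W" for Y
        using matching_pair_unique[OF M e, of X Y] Fs unfolding restrict_matching_def by blast
      moreover have "(Y, X) \<notin> ?W" for Y
        using matching_pair_unique[OF M e, of Y X] Fs Xs unfolding restrict_matching_def by blast
      ultimately show ?thesis using Xs unfolding critical_iff by blast
    qed
    moreover have "{v} \<in> critical skel ?W"
      using vV vsk unfolding critical_iff restrict_matching_def by blast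
    ultimately show "insert {v} (ridges r q) \<subseteq> critical skel ?W"
      by blast
  qed
  have "inj_on (\<lambda>i. T - {i, q i}) (T - {r})"
  proof (rule inj_onI)
    fix i j assume ij: "i \<in> T - {r}" "j \<in> T - {r}" "T - {i, q i} = T - {j, q j}"
    then have "T - {i} = T - {j}"
      using matching_pair_unique[OF M, of "T - {i, q i}" "T - {i}" "T - {j, q j}" "T - {j}"] q by blast
    then show "i = j" using ij by blast
  qed
  then have "card (ridges r q) + 1 = card T"
    using card_facet[OF r(1)] unfolding ridges_def by (simp add: card_image)
  with r(1) Vq _ crit show ?thesis
    by (rule that) (use q in blast)
qed

text \<open>The structure of \<open>V\<close> bounds the number from above by one vertex and
  \<open>card T - 1\<close> ridges, which meets the lower bound. Optimal matchings on the skeleton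
  are thereby characterised by this number.\<close>

lemma restrict_card_critical:
  assumes V: "V \<in> optimal_matchings full"
  shows "card (critical skel (restrict_matching skel V)) = card T"
proof -
  let ?W = "restrict_matching skel V"
  obtain r q v where s: "critical skel ?W = insert {v} (ridges r q)" "card (ridges r q) + 1 = card T"
    using optimal_full_structure[OF V] by metis
  have "card (critical skel ?W) \<le> card T"
    unfolding s(1) using s(2) card_T by (intro card_insert_le_m1) auto
  moreover have "acyclic_matching skel ?W"
    using V restrict_acyclic unfolding optimal_full_iff by blast
  ultimately show ?thesis
    using card_critical_skel_ge[of ?W] by linarith
qed

lemma optimal_full_exists: "\<exists>V. V \<in> optimal_matchings full"
  using cone_matching optimal_full_iff by blast

section \<open>Optimality on the skeleton and the fibers of restriction\<close>

lemma optimal_skel_iff: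
  "W \<in> optimal_matchings skel \<longleftrightarrow> acyclic_matching skel W \<and> card (critical skel W) = card T"
proof -
  obtain V where V: "V \<in> optimal_matchings full" using optimal_full_exists by blast
  have "acyclic_matching skel (restrict_matching skel V)"
    using V restrict_acyclic optimal_full_iff by blast
  moreover have "card T \<le> card (critical skel W)" if "acyclic_matching skel W" for W
    using card_critical_skel_ge[OF that] by linarith
  ultimately show ?thesis
    using optimal_matchings_iff[OF _ restrict_card_critical[OF V]] by blast
qed

lemma restrict_optimal:
  "V \<in> optimal_matchings full \<Longrightarrow> restrict_matching skel V \<in> optimal_matchings skel"
  using restrict_card_critical restrict_acyclic optimal_skel_iff optimal_full_iff by blast

text \<open>Since one of the \<open>card T\<close> critical simplices is a vertex, at most
  \<open>card T - 1\<close> are ridges, and the tree already accounts for that many. The graph of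
  critical ridges is therefore exactly a tree.\<close>

lemma optimal_skel_ridges:
  assumes W: "W \<in> optimal_matchings skel" and "r \<in> T" and p: "parents W r p d"
  shows "ridges r p = {X \<in> critical skel W. card X + 2 = card T}" (is "_ = ?C")
proof -
  have "finite ?C" unfolding critical_def by simp
  moreover have "card ?C \<le> card (ridges r p)"
    using card_critical_skel_ge[of W] card_ridges[OF p \<open>r \<in> T\<close>] W unfolding optimal_skel_iff by simp
  ultimately show ?thesis
    using ridges_critical[OF p] card_seteq by blast
qed

text \<open>The extension matches all \<open>card T - 1\<close> tree ridges, so at most one of the
  \<open>card T\<close> critical simplices survives.\<close>

lemma extend_optimal:
  assumes W: "W \<in> optimal_matchings skel" and r: "r \<in> T" and p: "parents W r p d"
  shows "extend W r p \<in> optimal_matchings full"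
proof -
  have ac: "acyclic_matching skel W" using W by (simp add: optimal_skel_iff)
  let ?V = "extend W r p"
  have V: "acyclic_matching full ?V"
    using extend_matching[OF ac r p] extend_acyclic[OF ac r p] by (simp add: acyclic_matching_def)
  have fin: "finite (critical skel W)" unfolding critical_def by simp
  have sub: "ridges r p \<subseteq> critical skel W" using ridges_critical[OF p] by blast
  have "card (critical full ?V) \<le> card (critical skel W - ridges r p)"
    using extend_critical[OF r] fin by (meson card_mono finite_Diff)
  also have "\<dots> = 1"
    using sub fin card_ridges[OF p r] W unfolding optimal_skel_iff
    by (simp add: card_Diff_subset finite_subset)
  finally have "card (critical full ?V) \<le> 1" .
  moreover have "finite (critical full ?V)" unfolding critical_def by simp
  then have "card (critical full ?V) \<noteq> 0" using critical_vertex_full[OF V] by auto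
  ultimately show ?thesis using V unfolding optimal_full_iff by simp
qed

lemma card_fiber:
  assumes W: "W \<in> optimal_matchings skel"
  shows "card {V \<in> optimal_matchings full. restrict_matching skel V = W} = card T"
proof -
  have ac: "acyclic_matching skel W" using W by (simp add: optimal_skel_iff)
  obtain p d where p: "\<And>r. r \<in> T \<Longrightarrow> parents W r (p r) (d r)"
    using parents_exist[OF ac] by metis
  have "{V \<in> optimal_matchings full. restrict_matching skel V = W} = (\<lambda>r. extend W r (p r)) ` T"
    (is "?F = ?I")
  proof
    show "?I \<subseteq> ?F"
      using extend_optimal[OF W _ p] extend_restrict[OF ac] by blast
    show "?F \<subseteq> ?I"
    proof
      fix V assume "V \<in> ?F"
      then have V: "V \<in> optimal_matchings full" and res: "restrict_matching skel V = W" by auto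
      obtain r q v where r: "r \<in> T" and Vq: "V = extend W r q"
        and q: "\<And>i. i \<in> T - {r} \<Longrightarrow> q i \<in> T - {i}"
        and crit: "critical skel W = insert {v} (ridges r q)"
        using optimal_full_structure[OF V] unfolding res by metis
      have "{X \<in> critical skel W. card X + 2 = card T} \<subseteq> ridges r q"
        unfolding crit using card_T by auto
      then have sub: "ridges r (p r) \<subseteq> ridges r q"
        using optimal_skel_ridges[OF W r p[OF r]] by simp
      \<comment> \<open>By \<open>sub\<close> the edges of \<open>q\<close> include those of the
        tree, and both maps have root \<open>r\<close>, so the depth of the chosen parent map forces
        the two to agree.\<close>
      have "q i = p r i" if "i \<in> T - {r}" for i
      proof (rule parent_unique[OF _ _ that])
        fix i assume i: "i \<in> T - {r}"
        show "p r i \<in> T \<and> d r (p r i) < d r i" using parentsD[OF p[OF r] i] by simp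
        obtain j where j: "j \<in> T - {r}" "T - {i, p r i} = T - {j, q j}"
          using sub i unfolding ridges_def by blast
        then have "{i, p r i} = {j, q j}"
          using ridge_eqD[of i "p r i" j "q j"] i q[of j] parentsD(1)[OF p[OF r] i] by blast
        then show "\<exists>j\<in>T - {r}. {i, p r i} = {j, q j}" using j by blast
      qed
      then have "V = extend W r (p r)" unfolding Vq extend_def by auto
      then show "V \<in> ?I" using r by blast
    qed
  qed
  moreover have "inj_on (\<lambda>r. extend W r (p r)) T"
  proof (rule inj_onI)
    fix r s assume rs: "r \<in> T" "s \<in> T" "extend W r (p r) = extend W s (p s)"
    have M: "is_matching full (extend W s (p s))"
      using extend_matching[OF ac rs(2) p[OF rs(2)]] .
    \<comment> \<open>The partner of the top face reveals the root.\<close>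
    have top: "(T - {x}, T) \<in> extend W x (p x)" for x
      unfolding extend_def by simp
    have "(T - {r}, T) \<in> extend W s (p s)"
      using top[of r] unfolding rs(3) .
    then have "T - {r} = T - {s}" using matching_pair_unique[OF M _ top[of s]] by blast
    then show "r = s" using rs by blast
  qed
  ultimately show ?thesis by (simp add: card_image)
qed

lemma restrict_image:
  "restrict_matching skel ` optimal_matchings full = optimal_matchings skel"
proof
  show "restrict_matching skel ` optimal_matchings full \<subseteq> optimal_matchings skel"
    using restrict_optimal by blast
  show "optimal_matchings skel \<subseteq> restrict_matching skel ` optimal_matchings full"
  proof
    fix W assume "W \<in> optimal_matchings skel"
    then have "card {V \<in> optimal_matchings full. restrict_matching skel V = W} \<noteq> 0"
      using card_fiber card_T by auto
    then have "{V \<in> optimal_matchings full. restrict_matching skel V = W} \<noteq> {}"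
      by (metis card.empty)
    then show "W \<in> restrict_matching skel ` optimal_matchings full" by blast
  qed
qed

section \<open>Top-dimensional simplices and the count\<close>

text \<open>The two sides could differ only over the empty matching, which is no simplex of the
  Morse complex. It is not optimal: it would leave all of \<open>skel\<close> critical, which has
  more than \<open>card T\<close> members, namely all vertices and an edge.\<close>

lemma top_simplices_skel: "top_simplices (morse_complex skel) = optimal_matchings skel"
proof -
  have count: "card (critical skel W) + 2 * card W = card skel" if "acyclic_matching skel W" for W
    using that card_critical[of skel W] unfolding acyclic_matching_def by simp
  have nonempty: "W \<noteq> {}" if W: "W \<in> optimal_matchings skel" for W
  proof
    assume "W = {}"
    then have "card skel = card T"
      using W count[of W] unfolding optimal_skel_iff by auto
    obtain a where a: "a \<in> T" using card_T by fastforce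
    then have "card (T - {a}) \<noteq> 0" using card_facet[of a] card_T by linarith
    then obtain b where "b \<in> T - {a}" by (metis card.empty ex_in_conv)
    then have ab: "a \<in> T" "b \<in> T" "a \<noteq> b" using a by auto
    have "insert {a, b} ((\<lambda>v. {v}) ` T) \<subseteq> skel"
      using ab card_T unfolding skel_def full_def by auto
    then have "card (insert {a, b} ((\<lambda>v. {v}) ` T)) \<le> card skel"
      by (intro card_mono) simp_all
    moreover have "{a, b} \<notin> (\<lambda>v. {v}) ` T" using ab by auto
    ultimately show False
      using finite_T \<open>card skel = card T\<close> by (simp add: card_image)
  qed
  obtain W0 where W0: "W0 \<in> optimal_matchings skel"
    using restrict_optimal optimal_full_exists by blast
  have le: "card (critical skel W) \<le> card (critical skel W') \<longleftrightarrow> card W' \<le> card W"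
    if "acyclic_matching skel W" "acyclic_matching skel W'" for W W'
    using count[OF that(1)] count[OF that(2)] by linarith
  show ?thesis
  proof (intro equalityI subsetI)
    fix W assume "W \<in> top_simplices (morse_complex skel)"
    then have W: "acyclic_matching skel W" and max: "\<And>W'. W' \<noteq> {} \<Longrightarrow> acyclic_matching skel W' \<Longrightarrow> card W' \<le> card W"
      unfolding top_simplices_def morse_complex_def by auto
    then have "card (critical skel W) \<le> card (critical skel W')" if "acyclic_matching skel W'" for W'
      using le[OF W that] that by (cases "W' = {}") auto
    then show "W \<in> optimal_matchings skel" using W unfolding optimal_matchings_def by blast
  next
    fix W assume W: "W \<in> optimal_matchings skel"
    then have ac: "acyclic_matching skel W"
      unfolding optimal_matchings_def by blast
    moreover have "card W' \<le> card W" if "acyclic_matching skel W'" for W'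
      using W that le[OF ac that] unfolding optimal_matchings_def by blast
    ultimately show "W \<in> top_simplices (morse_complex skel)"
      using nonempty[OF W] unfolding top_simplices_def morse_complex_def by blast
  qed
qed

lemma card_optimal_full:
  "card (optimal_matchings full) = card T * card (optimal_matchings skel)"
proof -
  let ?fib = "\<lambda>W. {V \<in> optimal_matchings full. restrict_matching skel V = W}"
  have "V \<subseteq> full \<times> full" if "V \<in> optimal_matchings full" for V
    using that matching_edge unfolding optimal_full_iff acyclic_matching_def by auto
  then have "optimal_matchings full \<subseteq> Pow (full \<times> full)" by blast
  then have fin: "finite (optimal_matchings full)"
    by (meson finite_Pow_iff finite_SigmaI finite_full finite_subset)
  then have fin': "finite (optimal_matchings skel)"
    using restrict_image by (metis finite_imageI)
  have "optimal_matchings full = (\<Union>W\<in>optimal_matchings skel. ?fib W)"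
    using restrict_optimal by blast
  also have "card \<dots> = (\<Sum>W\<in>optimal_matchings skel. card (?fib W))"
    using fin fin' by (intro card_UN_disjoint) auto
  also have "\<dots> = card T * card (optimal_matchings skel)"
    using card_fiber by simp
  finally show ?thesis .
qed

end

theorem mainTheorem5:
  fixes n :: nat
  assumes "n \<ge> 3"
  defines "L \<equiv> skeleton (n - 2) (std_simplex n)"
  shows "restrict_matching L ` optimal_matchings (std_simplex n) = optimal_matchings L
       \<and> (\<forall>W\<in>optimal_matchings L.
           card {V\<in>optimal_matchings (std_simplex n). restrict_matching L V = W} = n + 1)
       \<and> f_opt n = (n + 1) * card (top_simplices (morse_complex L))"
proof -
  interpret simplex "{0..n}"
    using \<open>n \<ge> 3\<close> by unfold_locales auto
  have "std_simplex n = full"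
    unfolding std_simplex_def full_def ..
  \<comment> \<open>As \<open>card {0..n}\<close> is \<open>n + 1\<close>, the bound
    \<open>n - 2 + 1\<close> on the cardinality is codimension at least two; for \<open>n\<close> at
    least 3 the subtraction does not truncate.\<close>
  moreover from this have "L = skel"
    unfolding L_def skeleton_def skel_def using \<open>n \<ge> 3\<close> by auto
  ultimately show ?thesis
    using restrict_image card_fiber card_optimal_full top_simplices_skel by (simp add: f_opt_def)
qed

end
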